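(* Let $p\in(1,\infty)$. There exists a constant $C_p>0$ depending only on $p$ such that for all $n\in\mathbb{N}=\{1,2,\ldots\}$ and all $\boldsymbol{\sigma}\in\{0,1\}^n$ the two-dimensional symmetrized digit shifted Hammersley point set $\mathcal{R}_{n,\boldsymbol{\sigma}}^{\mathrm{sym}}$, which has $N=2^{n+1}$ elements, satisfies $$L_{p,N}(\mathcal{R}_{n,\boldsymbol{\sigma}}^{\mathrm{sym}})\le C_p\,\frac{\sqrt{\log N}}{N}.$$
   Context: For a finite set (or multiset) $\mathcal{P}=\{\boldsymbol{x}_0,\ldots,\boldsymbol{x}_{N-1}\}$ of $N$ points in $[0,1)^2$, the local discrepancy is $$D_N(\mathcal{P},\boldsymbol{t})=\frac{A_N([\boldsymbol{0},\boldsymbol{t}),\mathcal{P})}{N}-t_1t_2,\qquad \boldsymbol{t}=(t_1,t_2)\in[0,1]^2,$$ where $A_N([\boldsymbol{0},\boldsymbol{t}),\mathcal{P})$ is the number of indices $k$ with $\boldsymbol{x}_k\in[\boldsymbol{0},\boldsymbol{t}):=[0,t_1)\times[0,t_2)$. The $L_p$-discrepancy is $$L_{p,N}(\mathcal{P})=\left(\int_{[0,1]^2}|D_N(\mathcal{P},\boldsymbol{t})|^p\,\mathrm{d}\boldsymbol{t}\right)^{1/p}.$$ For $\boldsymbol{\sigma}=(\sigma_1,\ldots,\sigma_n)\in\{0,1\}^n$ the two-dimensional digit shifted Hammersley point set is $$\mathcal{R}_{n,\boldsymbol{\sigma}}=\Big\{\Big(\frac{t_n}{2}+\frac{t_{n-1}}{2^2}+\cdots+\frac{t_1}{2^n},\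 \frac{t_1\oplus\sigma_1}{2}+\frac{t_2\oplus\sigma_2}{2^2}+\cdots+\frac{t_n\oplus\sigma_n}{2^n}\Big) : t_1,\ldots,t_n\in\{0,1\}\Big\},$$ where $t\oplus\sigma=t+\sigma \pmod 2$. It has $2^n$ elements. The two-dimensional symmetrized digit shifted Hammersley point set is $$\mathcal{R}_{n,\boldsymbol{\sigma}}^{\mathrm{sym}}=\mathcal{R}_{n,\boldsymbol{\sigma}}\cup\mathcal{R}_{n,\boldsymbol{\sigma}_*},\qquad \boldsymbol{\sigma}_*=(\sigma_1\oplus1,\sigma_2\oplus1,\ldots,\sigma_n\oplus1).$$ It has $N=2^{n+1}$ elements. $\log$ is the natural logarithm. *)

theory Defs
  imports "HOL-Analysis.Analysis"
begin

definition local_discrepancy :: "(real \<times> real) set \<Rightarrow> real \<times> real \<Rightarrow> real" where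
  "local_discrepancy P t =
     real (card (P \<inter> {0..<fst t} \<times> {0..<snd t})) / real (card P) - fst t * snd t"

definition Lp_discrepancy :: "real \<Rightarrow> (real \<times> real) set \<Rightarrow> real" where
  "Lp_discrepancy p P =
     (LINT t:{0..1} \<times> {0..1}|lborel. \<bar>local_discrepancy P t\<bar> powr p) powr (1 / p)"

(* A binary vector of length n is a function nat => nat, of which only the
   values at 1, ..., n are used. *)

definition hammersley_point :: "nat \<Rightarrow> (nat \<Rightarrow> nat) \<Rightarrow> (nat \<Rightarrow> nat) \<Rightarrow> real \<times> real" where
  "hammersley_point n \<sigma> t =
     ((\<Sum>i=1..n. real (t (n + 1 - i)) / 2 ^ i),
      (\<Sum>i=1..n. real ((t i + \<sigma> i) mod 2) / 2 ^ i))"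

definition shifted_hammersley :: "nat \<Rightarrow> (nat \<Rightarrow> nat) \<Rightarrow> (real \<times> real) set" where
  "shifted_hammersley n \<sigma> = {hammersley_point n \<sigma> t | t. t \<in> {1..n} \<rightarrow> {0, 1}}"

definition sym_shifted_hammersley :: "nat \<Rightarrow> (nat \<Rightarrow> nat) \<Rightarrow> (real \<times> real) set" where
  "sym_shifted_hammersley n \<sigma> =
     shifted_hammersley n \<sigma> \<union> shifted_hammersley n (\<lambda>i. (\<sigma> i + 1) mod 2)"

end

theory Submission
  imports Defs
begin

text \<open>In each column \<open>X / 2 ^ n\<close> the symmetrized set has two points, at complementary heights
  \<open>Y\<close> and \<open>2 ^ n - 1 - Y\<close> (times \<open>2 ^ - n\<close>), where \<open>Y\<close> is the shifted digit reversal of \<open>X\<close>. On the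
  grid, \<open>N\<close> times the local discrepancy at \<open>(a, b) / 2 ^ n\<close> is therefore the sum over \<open>X < a\<close> of a
  function of \<open>Y\<close> that has mean zero, total variation at most \<open>2\<close> and is symmetric under complement.
  For fixed \<open>b\<close>, revealing the binary digits of \<open>a\<close> from the top turns this sum into a martingale
  of length \<open>n\<close> with bounded increments: fixing a leading digit of \<open>X\<close> fixes a trailing digit of \<open>Y\<close>, and
  passing to a residue class of heights preserves the bounds on the variation and on the total. The
  symmetry makes the overall mean vanish. Hence the sum divided by \<open>sqrt n\<close> has bounded exponential moments,
  which dominate all \<open>p\<close>-th moments. Off the grid the discrepancy changes by \<open>O(1 / N)\<close> only.\<close>

section \<open>Shifted digit reversal\<close>

lemma double_plus_bit_inj:
  fixes a b x y :: nat
  shows "2 * a + x mod 2 = 2 * b + y mod 2 \<Longrightarrow> a = b \<and> x mod 2 = y mod 2"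
  by presburger

lemma shifted_bit_inj:
  fixes x y s :: nat
  shows "(x + s) mod 2 = (y + s) mod 2 \<Longrightarrow> x < 2 \<Longrightarrow> y < 2 \<Longrightarrow> x = y"
  by presburger

lemma flipped_bit:
  fixes x s :: nat
  shows "(x + (s + 1) mod 2) mod 2 + (x + s) mod 2 = 1"
  by presburger

text \<open>The leading digit of \<open>X\<close> becomes the trailing digit of the height. The
  recursion peels off the leading digit first, the order in which the digits of \<open>a\<close> are
  revealed in the martingale argument.\<close>

fun digit_reversal :: "nat \<Rightarrow> (nat \<Rightarrow> nat) \<Rightarrow> nat \<Rightarrow> nat" where
  "digit_reversal 0 \<sigma> X = 0"
| "digit_reversal (Suc n) \<sigma> X =
     2 * digit_reversal n \<sigma> (X mod 2 ^ n) + (X div 2 ^ n + \<sigma> (Suc n)) mod 2"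

lemma digit_reversal_low:
  "X < 2 ^ n \<Longrightarrow> digit_reversal (Suc n) \<sigma> X = 2 * digit_reversal n \<sigma> X + \<sigma> (Suc n) mod 2"
  by simp

lemma digit_reversal_high:
  "X < 2 ^ n \<Longrightarrow>
    digit_reversal (Suc n) \<sigma> (2 ^ n + X) = 2 * digit_reversal n \<sigma> X + (1 + \<sigma> (Suc n)) mod 2"
  by simp

lemma digit_reversal_less: "digit_reversal n \<sigma> X < 2 ^ n"
proof (induction n arbitrary: X)
  case (Suc n)
  have "(X div 2 ^ n + \<sigma> (Suc n)) mod 2 < 2" by simp
  with Suc[of "X mod 2 ^ n"] show ?case unfolding digit_reversal.simps power_Suc by linarith
qed simp

text \<open>The parity of the value determines the leading digit of \<open>X\<close> and its integer
  half determines the remaining digits. An injective self-map of a finite set is onto.\<close>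

lemma bij_betw_digit_reversal: "bij_betw (digit_reversal n \<sigma>) {..<2 ^ n} {..<2 ^ n}"
proof -
  have "inj_on (digit_reversal n \<sigma>) {..<2 ^ n}"
  proof (induction n)
    case (Suc n)
    show ?case
    proof (rule inj_onI)
      fix X Y
      assume *: "X \<in> {..<2 ^ Suc n}" "Y \<in> {..<2 ^ Suc n}"
        "digit_reversal (Suc n) \<sigma> X = digit_reversal (Suc n) \<sigma> Y"
      have eq: "2 * digit_reversal n \<sigma> (X mod 2 ^ n) + (X div 2 ^ n + \<sigma> (Suc n)) mod 2
        = 2 * digit_reversal n \<sigma> (Y mod 2 ^ n) + (Y div 2 ^ n + \<sigma> (Suc n)) mod 2"
        using *(3) by simp
      have r: "digit_reversal n \<sigma> (X mod 2 ^ n) = digit_reversal n \<sigma> (Y mod 2 ^ n)"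
        and b: "(X div 2 ^ n + \<sigma> (Suc n)) mod 2 = (Y div 2 ^ n + \<sigma> (Suc n)) mod 2"
        using double_plus_bit_inj[OF eq] by simp_all
      have "X mod 2 ^ n = Y mod 2 ^ n"
        using inj_onD[OF Suc r] by simp
      moreover have "X div 2 ^ n < 2" "Y div 2 ^ n < 2"
        using * by (simp_all add: less_mult_imp_div_less)
      with b have "X div 2 ^ n = Y div 2 ^ n" by (rule shifted_bit_inj)
      ultimately show "X = Y" by (metis div_mult_mod_eq)
    qed
  qed (simp add: lessThan_Suc)
  moreover have "digit_reversal n \<sigma> ` {..<2 ^ n} \<subseteq> {..<2 ^ n}"
    by (auto simp: digit_reversal_less)
  ultimately show ?thesis
    unfolding bij_betw_def by (simp add: endo_inj_surj)
qed

text \<open>Complementing the shift flips every digit of the height, so the second half of the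
  symmetrized set is the vertical mirror image of the first.\<close>

lemma digit_reversal_shift_complement:
  "digit_reversal n (\<lambda>i. (\<sigma> i + 1) mod 2) X + digit_reversal n \<sigma> X = 2 ^ n - 1"
proof (induction n arbitrary: X)
  case (Suc n)
  have "(X div 2 ^ n + (\<sigma> (Suc n) + 1) mod 2) mod 2 + (X div 2 ^ n + \<sigma> (Suc n)) mod 2 = 1"
    by (rule flipped_bit)
  moreover have "(2::nat) ^ n \<ge> 1" by simp
  ultimately show ?case
    using Suc[of "X mod 2 ^ n"] unfolding digit_reversal.simps power_Suc by linarith
qed simp

text \<open>Complementing \<open>X\<close> flips all its digits and hence all digits of the height.
  This gives the sequence of heights the left-right symmetry that
  \<open>mean_partial_sum_symmetric\<close> exploits.\<close>

lemma digit_reversal_complement: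
  "X < 2 ^ n \<Longrightarrow>
    digit_reversal n \<sigma> (2 ^ n - 1 - X) + digit_reversal n \<sigma> X = 2 ^ n - 1"
proof (induction n arbitrary: X)
  case (Suc n)
  show ?case
  proof (cases "X < 2 ^ n")
    case True
    have e: "2 ^ Suc n - 1 - X = 2 ^ n + (2 ^ n - 1 - X)" using True by simp
    have l: "2 ^ n - 1 - X < 2 ^ n" using True by simp
    have "\<sigma> (Suc n) mod 2 + (1 + \<sigma> (Suc n)) mod 2 = 1" by presburger
    then show ?thesis
      using Suc.IH[OF True]
      unfolding e digit_reversal_high[OF l] digit_reversal_low[OF True] using True by simp
  next
    case False
    define Z where "Z = X - 2 ^ n"
    have Z: "Z < 2 ^ n" "X = 2 ^ n + Z" using False Suc.prems by (auto simp: Z_def)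
    have e: "2 ^ Suc n - 1 - X = 2 ^ n - 1 - Z" using Z by simp
    have l: "2 ^ n - 1 - Z < 2 ^ n" using Z by simp
    have "\<sigma> (Suc n) mod 2 + (1 + \<sigma> (Suc n)) mod 2 = 1" by presburger
    then show ?thesis
      using Suc.IH[OF Z(1)]
      unfolding e unfolding Z(2) digit_reversal_low[OF l] digit_reversal_high[OF Z(1)]
      using Z(1) by simp
  qed
qed simp

lemma lessThan_double_pow2:
  "{..<2 ^ Suc n} = {..<2 ^ n} \<union> (\<lambda>X. 2 ^ n + X) ` {..<2 ^ n :: nat}"
proof -
  have "X \<in> (\<lambda>X. 2 ^ n + X) ` {..<2 ^ n}" if "X < 2 * 2 ^ n" "\<not> X < 2 ^ n" for X :: nat
    using that by (intro image_eqI[of _ _ "X - 2 ^ n"]) auto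
  then show ?thesis by auto
qed

lemma sum_double_pow2:
  fixes f :: "nat \<Rightarrow> real"
  shows "(\<Sum>X<2 ^ Suc n. f X) = (\<Sum>X<2 ^ n. f X) + (\<Sum>X<2 ^ n. f (2 ^ n + X))"
proof -
  have "(\<Sum>X<2 ^ Suc n. f X) = (\<Sum>X<2 ^ n. f X) + (\<Sum>X\<in>(\<lambda>X. 2 ^ n + X) ` {..<2 ^ n}. f X)"
    unfolding lessThan_double_pow2 by (intro sum.union_disjoint) auto
  then show ?thesis by (simp add: sum.reindex)
qed

lemma sum_even_odd:
  fixes f :: "nat \<Rightarrow> real"
  shows "(\<Sum>Y<2 * m. f Y) = (\<Sum>Y<m. f (2 * Y)) + (\<Sum>Y<m. f (2 * Y + 1))"
  by (induction m) simp_all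

section \<open>The point sets indexed by columns\<close>

lemma hammersley_point_Suc:
  "hammersley_point (Suc n) \<sigma> t =
     (real (t (Suc n)) / 2 + fst (hammersley_point n \<sigma> t) / 2,
      snd (hammersley_point n \<sigma> t) + real ((t (Suc n) + \<sigma> (Suc n)) mod 2) / 2 ^ Suc n)"
proof -
  have "(\<Sum>i=1..Suc n. real (t (Suc n + 1 - i)) / 2 ^ i)
      = real (t (Suc n)) / 2 + (\<Sum>i=Suc 1..Suc n. real (t (Suc n + 1 - i)) / 2 ^ i)"
    by (subst sum.atLeast_Suc_atMost) simp_all
  also have "(\<Sum>i=Suc 1..Suc n. real (t (Suc n + 1 - i)) / 2 ^ i)
      = (\<Sum>i=1..n. real (t (n + 1 - i)) / 2 ^ i) / 2"
    unfolding sum.atLeast_Suc_atMost_Suc_shift by (simp add: sum_divide_distrib o_def mult.commute)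
  finally show ?thesis by (simp add: hammersley_point_def)
qed

text \<open>A new digit \<open>t (Suc n)\<close> is the most significant one in the first coordinate
  and the least significant one in the second, just as in the recursion for
  \<open>digit_reversal\<close>. The column index \<open>X\<close> has \<open>t 1\<close> as its
  lowest digit.\<close>

lemma shifted_hammersley_eq:
  "shifted_hammersley n \<sigma> =
     (\<lambda>X. (real X / 2 ^ n, real (digit_reversal n \<sigma> X) / 2 ^ n)) ` {..<2 ^ n}"
proof (induction n)
  case 0
  have "(\<lambda>_. 0) \<in> {1..0::nat} \<rightarrow> {0, 1::nat}" by simp
  then show ?case by (auto simp: shifted_hammersley_def hammersley_point_def lessThan_Suc)
next
  case (Suc n)
  let ?f = "\<lambda>n X. (real X / 2 ^ n, real (digit_reversal n \<sigma> X) / 2 ^ n)"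
  have rec: "hammersley_point (Suc n) \<sigma> t = ?f (Suc n) (t (Suc n) * 2 ^ n + X)"
    if "hammersley_point n \<sigma> t = ?f n X" "X < 2 ^ n" for t X
  proof -
    have "digit_reversal (Suc n) \<sigma> (t (Suc n) * 2 ^ n + X) =
        2 * digit_reversal n \<sigma> X + (t (Suc n) + \<sigma> (Suc n)) mod 2"
      using that by simp
    then show ?thesis
      unfolding hammersley_point_Suc that(1) by (simp add: field_simps del: digit_reversal.simps)
  qed
  show ?case
  proof (intro equalityI subsetI)
    fix z assume "z \<in> shifted_hammersley (Suc n) \<sigma>"
    then obtain t where t: "t \<in> {1..Suc n} \<rightarrow> {0, 1}" "z = hammersley_point (Suc n) \<sigma> t"
      by (auto simp: shifted_hammersley_def)
    have "t \<in> {1..n} \<rightarrow> {0, 1}" using t(1) by (simp add: Pi_iff)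
    then have "hammersley_point n \<sigma> t \<in> shifted_hammersley n \<sigma>"
      by (auto simp: shifted_hammersley_def)
    then obtain X where X: "X < 2 ^ n" "hammersley_point n \<sigma> t = ?f n X"
      unfolding Suc.IH by auto
    have "t (Suc n) \<in> {0, 1}" using t(1) by auto
    then have "t (Suc n) * 2 ^ n + X < 2 ^ Suc n" using X by auto
    then show "z \<in> ?f (Suc n) ` {..<2 ^ Suc n}"
      using rec[OF X(2,1)] unfolding t(2) by blast
  next
    fix z assume "z \<in> ?f (Suc n) ` {..<2 ^ Suc n}"
    then obtain X where X: "X < 2 ^ Suc n" "z = ?f (Suc n) X" by auto
    have "?f n (X mod 2 ^ n) \<in> shifted_hammersley n \<sigma>"
      unfolding Suc.IH by (intro imageI) simp
    then obtain t where t: "t \<in> {1..n} \<rightarrow> {0, 1}" "hammersley_point n \<sigma> t = ?f n (X mod 2 ^ n)"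
      by (auto simp: shifted_hammersley_def)
    \<comment> \<open>Only the digits at \<open>1..n\<close> enter
      \<open>hammersley_point n\<close>, so the leading digit of \<open>X\<close> can be written at
      \<open>Suc n\<close> without moving the shorter point.\<close>
    define t' where "t' = t(Suc n := X div 2 ^ n)"
    have "X div 2 ^ n < 2" using X(1) by (simp add: less_mult_imp_div_less)
    then have t': "t' \<in> {1..Suc n} \<rightarrow> {0, 1}"
      using t(1) by (force simp: t'_def Pi_iff)
    have "hammersley_point n \<sigma> t' = hammersley_point n \<sigma> t"
      unfolding hammersley_point_def t'_def by (auto intro!: sum.cong)
    with t(2) have "hammersley_point (Suc n) \<sigma> t' = ?f (Suc n) (t' (Suc n) * 2 ^ n + X mod 2 ^ n)"
      by (intro rec) auto
    also have "t' (Suc n) * 2 ^ n + X mod 2 ^ n = X" by (simp only: t'_def fun_upd_same div_mult_mod_eq)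
    finally have "z = hammersley_point (Suc n) \<sigma> t'" by (simp only: X(2))
    then show "z \<in> shifted_hammersley (Suc n) \<sigma>"
      using t' unfolding shifted_hammersley_def by blast
  qed
qed

lemma sym_shifted_hammersley_eq:
  "sym_shifted_hammersley n \<sigma> =
     (\<lambda>X. (real X / 2 ^ n, real (digit_reversal n \<sigma> X) / 2 ^ n)) ` {..<2 ^ n} \<union>
     (\<lambda>X. (real X / 2 ^ n, real (2 ^ n - 1 - digit_reversal n \<sigma> X) / 2 ^ n)) ` {..<2 ^ n}"
proof -
  have "digit_reversal n (\<lambda>i. (\<sigma> i + 1) mod 2) X = 2 ^ n - 1 - digit_reversal n \<sigma> X" for X
    using digit_reversal_shift_complement[of n \<sigma> X] by simp
  then show ?thesis unfolding sym_shifted_hammersley_def shifted_hammersley_eq by simp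
qed

lemma card_sym_shifted_hammersley_filter:
  assumes "n \<ge> 1"
  shows "card (sym_shifted_hammersley n \<sigma> \<inter> A) =
    card {X. X < 2 ^ n \<and> (real X / 2 ^ n, real (digit_reversal n \<sigma> X) / 2 ^ n) \<in> A} +
    card {X. X < 2 ^ n \<and> (real X / 2 ^ n, real (2 ^ n - 1 - digit_reversal n \<sigma> X) / 2 ^ n) \<in> A}"
    (is "_ = card ?F + card ?G")
proof -
  let ?f = "\<lambda>X. (real X / 2 ^ n, real (digit_reversal n \<sigma> X) / 2 ^ n)"
  let ?g = "\<lambda>X. (real X / 2 ^ n, real (2 ^ n - 1 - digit_reversal n \<sigma> X) / 2 ^ n)"
  \<comment> \<open>The two points of a column never coincide: that would make \<open>2 ^ n\<close>
    odd, whereas \<open>n \<ge> 1\<close>. Hence the union is disjoint and the counts add.\<close>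
  have "digit_reversal n \<sigma> X \<noteq> 2 ^ n - 1 - digit_reversal n \<sigma> X" for X
  proof
    assume "digit_reversal n \<sigma> X = 2 ^ n - 1 - digit_reversal n \<sigma> X"
    then have "2 * digit_reversal n \<sigma> X + 1 = 2 ^ n"
      using digit_reversal_less[of n \<sigma> X] by linarith
    moreover have "even (2 ^ n :: nat)" using assms by simp
    ultimately show False by presburger
  qed
  then have disj: "?f ` ?F \<inter> ?g ` ?G = {}" by auto
  have "sym_shifted_hammersley n \<sigma> \<inter> A = ?f ` ?F \<union> ?g ` ?G"
    unfolding sym_shifted_hammersley_eq by blast
  then have "card (sym_shifted_hammersley n \<sigma> \<inter> A) = card (?f ` ?F) + card (?g ` ?G)"
    using disj by (simp add: card_Un_disjoint)
  also have "card (?f ` ?F) = card ?F" by (intro card_image inj_onI) simp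
  also have "card (?g ` ?G) = card ?G" by (intro card_image inj_onI) simp
  finally show ?thesis .
qed

lemma card_sym_shifted_hammersley:
  assumes "n \<ge> 1"
  shows "card (sym_shifted_hammersley n \<sigma>) = 2 ^ (n + 1)"
  using card_sym_shifted_hammersley_filter[OF assms, of \<sigma> UNIV] by simp

section \<open>A two-point exponential moment bound\<close>

lemma cosh_le_exp_square: "cosh x \<le> exp (x\<^sup>2)" for x :: real
proof (cases "\<bar>x\<bar> \<le> 1")
  case True
  \<comment> \<open>Averaging this bound over \<open>x\<close> and \<open>-x\<close> cancels the
    linear terms.\<close>
  have *: "exp y \<le> 1 + y + y\<^sup>2" if "\<bar>y\<bar> \<le> 1" for y :: real
  proof (cases "y \<ge> 0")
    case True then show ?thesis using exp_bound[of y] that by simp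
  next
    case False
    have "exp (-y) \<ge> 1 - y" using exp_ge_add_one_self[of "-y"] by simp
    then have "exp y \<le> 1 / (1 - y)" using False by (simp add: exp_minus field_simps)
    also have "\<dots> \<le> 1 + y + y\<^sup>2"
    proof -
      \<comment> \<open>The product equals \<open>1 - y ^ 3\<close>, and \<open>y\<close> is
        negative here.\<close>
      have "1 \<le> (1 + y + y\<^sup>2) * (1 - y)"
      proof -
        have "y * y\<^sup>2 \<le> 0" using False by (intro mult_nonpos_nonneg) auto
        then show ?thesis by (simp add: algebra_simps power2_eq_square)
      qed
      then show ?thesis using False by (simp add: pos_divide_le_eq)
    qed
    finally show ?thesis .
  qed
  have "cosh x \<le> 1 + x\<^sup>2"
    using *[of x] *[of "-x"] True by (simp add: cosh_field_def)
  also have "\<dots> \<le> exp (x\<^sup>2)" by (rule exp_ge_add_one_self)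
  finally show ?thesis .
next
  case False
  have "cosh x \<le> exp \<bar>x\<bar>"
    unfolding cosh_field_def by (cases "x \<ge> 0") auto
  also have "\<bar>x\<bar> \<le> x\<^sup>2"
    using False by (metis abs_ge_zero less_imp_le linorder_not_le mult_left_mono mult.right_neutral power2_abs power2_eq_square)
  finally show ?thesis by simp
qed

section \<open>Variation and passage to residue classes modulo 2\<close>

definition variation :: "nat \<Rightarrow> (nat \<Rightarrow> real) \<Rightarrow> real" where
  "variation m v = (\<Sum>Y<m - 1. \<bar>v (Suc Y) - v Y\<bar>)"

lemma sum_jumps_le_variation:
  "(\<Sum>Y<m. \<bar>v (2 * Y + 1) - v (2 * Y)\<bar>) \<le> variation (2 * m) v"
proof -
  have "(\<Sum>Y<m. \<bar>v (2 * Y + 1) - v (2 * Y)\<bar>)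
      = (\<Sum>Z\<in>(\<lambda>Y. 2 * Y) ` {..<m}. \<bar>v (Suc Z) - v Z\<bar>)"
    by (subst sum.reindex) (auto simp: inj_on_def)
  also have "\<dots> \<le> variation (2 * m) v"
    unfolding variation_def by (intro sum_mono2) auto
  finally show ?thesis .
qed

text \<open>A jump of the subsampled function spans two consecutive jumps of \<open>v\<close>, and
  the pairs used for different \<open>Y\<close> are disjoint.\<close>

lemma variation_subsample_le:
  assumes "s < 2"
  shows "variation m (\<lambda>Y. v (2 * Y + s)) \<le> variation (2 * m) v"
proof -
  let ?D = "\<lambda>Z. \<bar>v (Suc Z) - v Z\<bar>"
  have "variation m (\<lambda>Y. v (2 * Y + s)) \<le> (\<Sum>Y<m - 1. ?D (2 * Y + s) + ?D (2 * Y + 1 + s))"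
    unfolding variation_def by (intro sum_mono) simp
  also have "\<dots> = (\<Sum>Z<2 * (m - 1). ?D (Z + s))"
    unfolding sum_even_odd by (simp add: sum.distrib)
  also have "\<dots> = (\<Sum>Z\<in>(\<lambda>Z. Z + s) ` {..<2 * (m - 1)}. ?D Z)"
    by (subst sum.reindex) (auto simp: inj_on_def)
  also have "\<dots> \<le> variation (2 * m) v"
    unfolding variation_def using assms by (intro sum_mono2) auto
  finally show ?thesis .
qed

text \<open>The even and odd sums have total at most \<open>V\<close> in absolute value by
  assumption, and difference at most \<open>V\<close> because it is a sum of jumps. Each is half of
  the total plus or minus the difference. With \<open>variation_subsample_le\<close> this makes the
  two bounds by \<open>V\<close> an invariant of the induction on digits.\<close>

lemma sum_subsample_le:
  assumes "s < 2" "variation (2 * m) v \<le> V" "\<bar>\<Sum>Y<2 * m. v Y\<bar> \<le> V"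
  shows "\<bar>\<Sum>Y<m. v (2 * Y + s)\<bar> \<le> V"
proof -
  have "\<bar>(\<Sum>Y<m. v (2 * Y + 1)) - (\<Sum>Y<m. v (2 * Y))\<bar> \<le> (\<Sum>Y<m. \<bar>v (2 * Y + 1) - v (2 * Y)\<bar>)"
    unfolding sum_subtractf[symmetric] by (rule sum_abs)
  also have "\<dots> \<le> V" using sum_jumps_le_variation[of v m] assms(2) by linarith
  finally have "\<bar>(\<Sum>Y<m. v (2 * Y + 1)) - (\<Sum>Y<m. v (2 * Y))\<bar> \<le> V" .
  moreover have "s = 0 \<or> s = 1" using assms(1) by auto
  ultimately show ?thesis using assms(3) unfolding sum_even_odd by auto
qed

section \<open>Sums over columns as a martingale\<close>

definition partial_sum :: "nat \<Rightarrow> (nat \<Rightarrow> nat) \<Rightarrow> (nat \<Rightarrow> real) \<Rightarrow> nat \<Rightarrow> real" where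
  "partial_sum n \<sigma> v a = (\<Sum>X<a. v (digit_reversal n \<sigma> X))"

text \<open>The expectation of the partial sum for \<open>a\<close> uniform on
  \<open>{..<2 ^ n}\<close>.\<close>

definition mean_partial_sum :: "nat \<Rightarrow> (nat \<Rightarrow> nat) \<Rightarrow> (nat \<Rightarrow> real) \<Rightarrow> real" where
  "mean_partial_sum n \<sigma> v = (\<Sum>a<2 ^ n. partial_sum n \<sigma> v a) / 2 ^ n"

lemma sum_digit_reversal: "(\<Sum>X<2 ^ n. f (digit_reversal n \<sigma> X)) = (\<Sum>Y<2 ^ n. f Y)"
  by (rule sum.reindex_bij_betw[OF bij_betw_digit_reversal])

lemma partial_sum_low:
  assumes "a \<le> 2 ^ n"
  shows "partial_sum (Suc n) \<sigma> v a = partial_sum n \<sigma> (\<lambda>Y. v (2 * Y + \<sigma> (Suc n) mod 2)) a"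
  unfolding partial_sum_def using assms
  by (intro sum.cong) (auto simp del: digit_reversal.simps simp: digit_reversal_low)

text \<open>The columns below \<open>2 ^ n\<close> are all present, so their heights exhaust one
  residue class modulo 2. The remaining columns have heights in the other class.\<close>

lemma partial_sum_high:
  assumes "a \<le> 2 ^ n"
  shows "partial_sum (Suc n) \<sigma> v (2 ^ n + a) =
    (\<Sum>Y<2 ^ n. v (2 * Y + \<sigma> (Suc n) mod 2)) +
    partial_sum n \<sigma> (\<lambda>Y. v (2 * Y + (1 + \<sigma> (Suc n)) mod 2)) a"
proof -
  have split: "(\<Sum>X<k + a. f X) = (\<Sum>X<k. f X) + (\<Sum>X<a. f (k + X))" for f :: "nat \<Rightarrow> real" and k
    by (induction a) (simp_all add: add.assoc)
  have "partial_sum (Suc n) \<sigma> v (2 ^ n + a) = partial_sum (Suc n) \<sigma> v (2 ^ n) +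
      (\<Sum>X<a. v (digit_reversal (Suc n) \<sigma> (2 ^ n + X)))"
    unfolding partial_sum_def by (rule split)
  also have "partial_sum (Suc n) \<sigma> v (2 ^ n) = (\<Sum>Y<2 ^ n. v (2 * Y + \<sigma> (Suc n) mod 2))"
    unfolding partial_sum_low[OF order_refl]
    unfolding partial_sum_def by (rule sum_digit_reversal)
  also have "(\<Sum>X<a. v (digit_reversal (Suc n) \<sigma> (2 ^ n + X))) =
      partial_sum n \<sigma> (\<lambda>Y. v (2 * Y + (1 + \<sigma> (Suc n)) mod 2)) a"
    unfolding partial_sum_def using assms
    by (intro sum.cong) (auto simp del: digit_reversal.simps simp: digit_reversal_high)
  finally show ?thesis .
qed

text \<open>Distinct columns have distinct heights, so every single partial sum already changes by
  at most the right-hand side.\<close>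

lemma mean_partial_sum_diff_le:
  "\<bar>mean_partial_sum n \<sigma> w - mean_partial_sum n \<sigma> v\<bar> \<le> (\<Sum>Y<2 ^ n. \<bar>w Y - v Y\<bar>)"
proof -
  let ?B = "\<Sum>Y<2 ^ n. \<bar>w Y - v Y\<bar>"
  have *: "\<bar>partial_sum n \<sigma> w a - partial_sum n \<sigma> v a\<bar> \<le> ?B" if "a < 2 ^ n" for a
  proof -
    have "\<bar>partial_sum n \<sigma> w a - partial_sum n \<sigma> v a\<bar>
        \<le> (\<Sum>X<a. \<bar>w (digit_reversal n \<sigma> X) - v (digit_reversal n \<sigma> X)\<bar>)"
      unfolding partial_sum_def sum_subtractf[symmetric] by (rule sum_abs)
    also have "\<dots> \<le> (\<Sum>X<2 ^ n. \<bar>w (digit_reversal n \<sigma> X) - v (digit_reversal n \<sigma> X)\<bar>)"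
      using that by (intro sum_mono2) auto
    also have "\<dots> = ?B" by (rule sum_digit_reversal)
    finally show ?thesis .
  qed
  have "\<bar>\<Sum>a<2 ^ n. partial_sum n \<sigma> w a - partial_sum n \<sigma> v a\<bar> \<le> (\<Sum>a<(2::nat) ^ n. ?B)"
    by (intro order_trans[OF sum_abs] sum_mono *) simp
  also have "\<dots> = 2 ^ n * ?B" by simp
  finally show ?thesis
    unfolding mean_partial_sum_def diff_divide_distrib[symmetric] sum_subtractf[symmetric]
    by (simp add: pos_divide_le_eq mult.commute)
qed

text \<open>The binary digits of \<open>a\<close>, read from the top, generate a filtration of the uniform
  measure on \<open>{..<2 ^ n}\<close>. Revealing one digit changes the conditional mean of the partial sum by at
  most \<open>V\<close>, so this is Azuma's inequality.\<close>

lemma exp_moment_partial_sum_le: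
  assumes "variation (2 ^ n) v \<le> V" "\<bar>\<Sum>Y<2 ^ n. v Y\<bar> \<le> V"
  shows "(\<Sum>a<2 ^ n. exp (l * (partial_sum n \<sigma> v a - mean_partial_sum n \<sigma> v)))
    \<le> 2 ^ n * exp (l\<^sup>2 * V\<^sup>2 * n)"
  using assms
proof (induction n arbitrary: v)
  case 0
  then show ?case by (simp add: partial_sum_def mean_partial_sum_def)
next
  case (Suc n)
  define r where "r = \<sigma> (Suc n) mod 2"
  define s where "s = (1 + \<sigma> (Suc n)) mod 2"
  define v0 where "v0 = (\<lambda>Y. v (2 * Y + r))"
  define v1 where "v1 = (\<lambda>Y. v (2 * Y + s))"
  have rs: "r < 2" "s < 2" "r = 0 \<and> s = 1 \<or> r = 1 \<and> s = 0"
    unfolding r_def s_def by presburger+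
  define T where "T = (\<Sum>Y<2 ^ n. v0 Y)"
  define m0 where "m0 = mean_partial_sum n \<sigma> v0"
  define m1 where "m1 = mean_partial_sum n \<sigma> v1"
  define m where "m = mean_partial_sum (Suc n) \<sigma> v"
  \<comment> \<open>Given the leading digit of \<open>a\<close>, the conditional means are
    \<open>m0 = m - d\<close> and \<open>T + m1 = m + d\<close>. So \<open>d\<close> is the size of
    the first martingale increment.\<close>
  define d where "d = (T + m1 - m0) / 2"
  define E where "E = exp (l\<^sup>2 * V\<^sup>2 * n)"
  have var: "variation (2 * 2 ^ n) v \<le> V" and tot: "\<bar>\<Sum>Y<2 * 2 ^ n. v Y\<bar> \<le> V"
    using Suc.prems by simp_all
  have low: "partial_sum (Suc n) \<sigma> v a = partial_sum n \<sigma> v0 a" if "a < 2 ^ n" for a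
    using that partial_sum_low[of a n \<sigma> v] by (simp add: v0_def r_def)
  have high: "partial_sum (Suc n) \<sigma> v (2 ^ n + a) = T + partial_sum n \<sigma> v1 a" if "a < 2 ^ n" for a
    using that partial_sum_high[of a n \<sigma> v] by (simp add: v0_def v1_def r_def s_def T_def)
  have "(\<Sum>a<2 ^ Suc n. partial_sum (Suc n) \<sigma> v a) =
      (\<Sum>a<2 ^ n. partial_sum n \<sigma> v0 a) + (\<Sum>a<2 ^ n. T + partial_sum n \<sigma> v1 a)"
    unfolding sum_double_pow2 by (intro arg_cong2[where f="(+)"] sum.cong) (auto simp: low high)
  then have m: "m = (m0 + T + m1) / 2"
    unfolding m_def m0_def m1_def mean_partial_sum_def
    by (simp add: sum.distrib field_simps)
  have "\<bar>T\<bar> \<le> V"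
    unfolding T_def v0_def by (rule sum_subsample_le[OF rs(1) var tot])
  \<comment> \<open>At each \<open>Y\<close> the functions \<open>v0\<close> and \<open>v1\<close>
    take neighbouring values of \<open>v\<close>, so their distance is a sum of jumps.\<close>
  moreover have "\<bar>m1 - m0\<bar> \<le> V"
  proof -
    have "\<bar>m1 - m0\<bar> \<le> (\<Sum>Y<2 ^ n. \<bar>v1 Y - v0 Y\<bar>)"
      unfolding m0_def m1_def by (rule mean_partial_sum_diff_le)
    also have "\<dots> = (\<Sum>Y<2 ^ n. \<bar>v (2 * Y + 1) - v (2 * Y)\<bar>)"
      using rs(3) unfolding v0_def v1_def by (auto simp: abs_minus_commute)
    also have "\<dots> \<le> V" using sum_jumps_le_variation[of v "2 ^ n"] var by linarith
    finally show ?thesis .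
  qed
  ultimately have d: "\<bar>d\<bar> \<le> V" unfolding d_def by (auto simp: abs_le_iff field_simps)
  have IH0: "(\<Sum>a<2 ^ n. exp (l * (partial_sum n \<sigma> v0 a - m0))) \<le> 2 ^ n * E"
    unfolding m0_def E_def
  proof (rule Suc.IH)
    show "variation (2 ^ n) v0 \<le> V"
      unfolding v0_def using variation_subsample_le[OF rs(1), of "2 ^ n" v] var by linarith
    show "\<bar>\<Sum>Y<2 ^ n. v0 Y\<bar> \<le> V"
      unfolding v0_def by (rule sum_subsample_le[OF rs(1) var tot])
  qed
  have IH1: "(\<Sum>a<2 ^ n. exp (l * (partial_sum n \<sigma> v1 a - m1))) \<le> 2 ^ n * E"
    unfolding m1_def E_def
  proof (rule Suc.IH)
    show "variation (2 ^ n) v1 \<le> V"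
      unfolding v1_def using variation_subsample_le[OF rs(2), of "2 ^ n" v] var by linarith
    show "\<bar>\<Sum>Y<2 ^ n. v1 Y\<bar> \<le> V"
      unfolding v1_def by (rule sum_subsample_le[OF rs(2) var tot])
  qed
  have e0: "l * (partial_sum n \<sigma> v0 a - m) = - (l * d) + l * (partial_sum n \<sigma> v0 a - m0)" for a
    unfolding m d_def by (simp add: field_simps)
  have e1: "l * (T + partial_sum n \<sigma> v1 a - m) = l * d + l * (partial_sum n \<sigma> v1 a - m1)" for a
    unfolding m d_def by (simp add: field_simps)
  have "(\<Sum>a<2 ^ Suc n. exp (l * (partial_sum (Suc n) \<sigma> v a - m))) =
      (\<Sum>a<2 ^ n. exp (l * (partial_sum n \<sigma> v0 a - m))) +
      (\<Sum>a<2 ^ n. exp (l * (T + partial_sum n \<sigma> v1 a - m)))"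
    unfolding sum_double_pow2 by (intro arg_cong2[where f="(+)"] sum.cong) (auto simp: low high)
  also have "\<dots> = exp (- (l * d)) * (\<Sum>a<2 ^ n. exp (l * (partial_sum n \<sigma> v0 a - m0))) +
      exp (l * d) * (\<Sum>a<2 ^ n. exp (l * (partial_sum n \<sigma> v1 a - m1)))"
    unfolding e0 e1 exp_add sum_distrib_left ..
  also have "\<dots> \<le> exp (- (l * d)) * (2 ^ n * E) + exp (l * d) * (2 ^ n * E)"
    by (intro add_mono mult_left_mono IH0 IH1) auto
  \<comment> \<open>The increments \<open>-d\<close> and \<open>d\<close> are equally likely; their
    average exponential is the \<open>cosh\<close> factor.\<close>
  also have "\<dots> = 2 ^ Suc n * E * cosh (l * d)"
    by (simp add: cosh_field_def field_simps)
  also have "\<dots> \<le> 2 ^ Suc n * E * exp (l\<^sup>2 * V\<^sup>2)"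
  proof -
    have "(l * d)\<^sup>2 \<le> l\<^sup>2 * V\<^sup>2"
      using power_mono[OF d abs_ge_zero, of 2] by (simp add: power_mult_distrib mult_left_mono)
    then have "cosh (l * d) \<le> exp (l\<^sup>2 * V\<^sup>2)"
      using cosh_le_exp_square[of "l * d"] by (meson exp_le_cancel_iff order_trans)
    then show ?thesis by (intro mult_left_mono) (auto simp: E_def)
  qed
  also have "\<dots> = 2 ^ Suc n * exp (l\<^sup>2 * V\<^sup>2 * Suc n)"
    unfolding E_def mult.assoc exp_add[symmetric] by (simp add: algebra_simps)
  finally show ?case unfolding m_def .
qed

text \<open>The summands form a palindrome with total zero, so the partial sums are antisymmetric
  under \<open>a \<mapsto> 2 ^ n - a\<close> and cancel in pairs.\<close>

lemma mean_partial_sum_symmetric: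
  assumes "\<And>Y. Y < 2 ^ n \<Longrightarrow> v (2 ^ n - 1 - Y) = v Y" "(\<Sum>Y<2 ^ n. v Y) = 0"
  shows "mean_partial_sum n \<sigma> v = 0"
proof -
  define u where "u = (\<lambda>X. v (digit_reversal n \<sigma> X))"
  define S where "S = partial_sum n \<sigma> v"
  have S: "S a = (\<Sum>X<a. u X)" for a by (simp add: S_def u_def partial_sum_def)
  have u: "u (2 ^ n - 1 - X) = u X" if "X < 2 ^ n" for X
  proof -
    have "digit_reversal n \<sigma> (2 ^ n - 1 - X) = 2 ^ n - 1 - digit_reversal n \<sigma> X"
      using digit_reversal_complement[OF that, of \<sigma>] by simp
    then show ?thesis
      unfolding u_def using assms(1)[OF digit_reversal_less] by simp
  qed
  have tot: "S (2 ^ n) = 0"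
    unfolding S u_def sum_digit_reversal by (rule assms(2))
  have anti: "S (2 ^ n - a) = - S a" if "a \<le> 2 ^ n" for a
    using that
  proof (induction a)
    case 0
    then show ?case using tot by (simp add: S)
  next
    case (Suc a)
    have "S (2 ^ n - a) = S (2 ^ n - Suc a) + u (2 ^ n - Suc a)"
      using Suc.prems by (simp add: S Suc_diff_Suc flip: sum.lessThan_Suc)
    moreover have "u (2 ^ n - Suc a) = u a" using u[of a] Suc.prems by simp
    moreover have "S (Suc a) = S a + u a" by (simp add: S)
    ultimately show ?case using Suc by simp
  qed
  have "(\<Sum>a\<le>2 ^ n. S a) = (\<Sum>a\<le>2 ^ n. S (2 ^ n - a))"
    by (rule sum.nat_diff_reindex[symmetric, where ?n="Suc (2 ^ n)", simplified lessThan_Suc_atMost diff_Suc_Suc])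
  also have "\<dots> = - (\<Sum>a\<le>2 ^ n. S a)"
    unfolding sum_negf[symmetric] by (intro sum.cong) (auto simp: anti)
  finally have "(\<Sum>a\<le>2 ^ n. S a) = 0" by simp
  then have "(\<Sum>a<2 ^ n. S a) = 0"
    using tot by (simp add: lessThan_Suc_atMost[symmetric])
  then show ?thesis by (simp add: mean_partial_sum_def S_def)
qed

section \<open>Exponential moments on the grid\<close>

text \<open>The two indicators are the two points of one column, so a column contributes the value at
  either of its heights.\<close>

definition strip_excess :: "nat \<Rightarrow> nat \<Rightarrow> nat \<Rightarrow> real" where
  "strip_excess n b Y = of_bool (Y < b) + of_bool (2 ^ n - 1 - Y < b) - 2 * real b / 2 ^ n"

lemma sum_jump_le_1:
  fixes m k :: nat
  shows "(\<Sum>Y<m. \<bar>of_bool (Suc Y < k) - of_bool (Y < k)\<bar> :: real) \<le> 1"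
proof -
  have "(\<Sum>Y<m. \<bar>of_bool (Suc Y < k) - of_bool (Y < k)\<bar> :: real) = (\<Sum>Y<m. of_bool (k = Suc Y))"
    by (intro sum.cong) auto
  also have "\<dots> = card ({..<m} \<inter> {Y. k = Suc Y})" by (simp add: of_bool_def sum.If_cases)
  also have "\<dots> \<le> card {k - 1}" unfolding of_nat_le_iff by (intro card_mono) auto
  finally show ?thesis by simp
qed

lemma variation_strip_excess:
  assumes "b \<le> 2 ^ n"
  shows "variation (2 ^ n) (strip_excess n b) \<le> 2"
proof -
  \<comment> \<open>Rewritten this way, both indicators belong to initial segments up to sign and a
    constant, and each jumps at most once.\<close>
  have *: "(of_bool (2 ^ n - 1 - Y < b) :: real) = 1 - of_bool (Y < 2 ^ n - b)" if "Y < 2 ^ n" for Y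
    using that assms by auto
  have "variation (2 ^ n) (strip_excess n b) \<le> (\<Sum>Y<2 ^ n - 1.
      \<bar>of_bool (Suc Y < b) - of_bool (Y < b)\<bar> +
      \<bar>of_bool (Suc Y < 2 ^ n - b) - of_bool (Y < 2 ^ n - b)\<bar>)"
    unfolding variation_def
  proof (rule sum_mono)
    fix Y :: nat assume "Y \<in> {..<2 ^ n - 1}"
    then have "Suc Y < 2 ^ n" "Y < 2 ^ n" by auto
    from *[OF this(1)] *[OF this(2)]
    show "\<bar>strip_excess n b (Suc Y) - strip_excess n b Y\<bar> \<le>
      \<bar>of_bool (Suc Y < b) - of_bool (Y < b)\<bar> +
      \<bar>of_bool (Suc Y < 2 ^ n - b) - of_bool (Y < 2 ^ n - b)\<bar>"
      unfolding strip_excess_def by linarith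
  qed
  also have "\<dots> \<le> 1 + 1"
    unfolding sum.distrib by (intro add_mono sum_jump_le_1)
  finally show ?thesis by simp
qed

lemma sum_strip_excess:
  assumes "b \<le> 2 ^ n"
  shows "(\<Sum>Y<2 ^ n. strip_excess n b Y) = 0"
proof -
  have "{..<2 ^ n} \<inter> {Y. Y < b} = {..<b}" using assms by auto
  then have 1: "(\<Sum>Y<2 ^ n. of_bool (Y < b) :: real) = b"
    by (simp add: of_bool_def sum.If_cases)
  have "(\<Sum>Y<2 ^ n. of_bool (2 ^ n - 1 - Y < b) :: real) = (\<Sum>Y<2 ^ n. of_bool (Y < b))"
    using sum.nat_diff_reindex[of "\<lambda>Y. of_bool (Y < b) :: real" "2 ^ n"] by simp
  then show ?thesis
    unfolding strip_excess_def sum_subtractf sum.distrib using 1 by simp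
qed

text \<open>The symmetry removes the mean; the factor \<open>4\<close> is \<open>V\<^sup>2\<close>
  for the variation bound \<open>V = 2\<close>.\<close>

lemma exp_moment_strip_excess_le:
  assumes "b \<le> 2 ^ n"
  shows "(\<Sum>a<2 ^ n. exp (l * partial_sum n \<sigma> (strip_excess n b) a)) \<le> 2 ^ n * exp (l\<^sup>2 * 4 * n)"
proof -
  have "strip_excess n b (2 ^ n - 1 - Y) = strip_excess n b Y" if "Y < 2 ^ n" for Y
    using that by (simp add: strip_excess_def)
  then have "mean_partial_sum n \<sigma> (strip_excess n b) = 0"
    using sum_strip_excess[OF assms] by (rule mean_partial_sum_symmetric)
  then show ?thesis
    using exp_moment_partial_sum_le[OF variation_strip_excess[OF assms], of l \<sigma>]
    by (simp add: sum_strip_excess[OF assms])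
qed

section \<open>From the grid to the unit square\<close>

text \<open>Moving the corner within its grid cell can only add points in column \<open>a\<close> or
  row \<open>b\<close>. Each holds at most one point, the row by injectivity of
  \<open>q\<close>.\<close>

lemma grid_count_bounds:
  fixes q :: "nat \<Rightarrow> nat"
  assumes "inj_on q {..<m}" "a < m"
    and x: "real a \<le> real m * x" "real m * x \<le> real a + 1"
    and y: "real b \<le> real m * y" "real m * y \<le> real b + 1"
  shows "card {X. X < a \<and> q X < b} \<le> card {X. X < m \<and> real X / m < x \<and> real (q X) / m < y}"
    and "card {X. X < m \<and> real X / m < x \<and> real (q X) / m < y} \<le> card {X. X < a \<and> q X < b} + 2"
proof -
  have m: "0 < real m" using assms(2) by simp
  have div: "real X / m < z \<longleftrightarrow> real X < real m * z" for X :: nat and z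
    using m by (simp add: pos_divide_less_eq mult.commute)
  have "finite {X. X < m \<and> real X / m < x \<and> real (q X) / m < y}"
    by (rule finite_subset[of _ "{..<m}"]) auto
  then show "card {X. X < a \<and> q X < b} \<le> card {X. X < m \<and> real X / m < x \<and> real (q X) / m < y}"
    unfolding div using assms(2) x(1) y(1) by (intro card_mono) (auto simp: div)
  let ?R = "{X. X < m \<and> q X = b}"
  have "card ?R = card (q ` ?R)"
    using assms(1) by (intro card_image[symmetric]) (auto simp: inj_on_def)
  also have "\<dots> \<le> card {b}" by (intro card_mono) auto
  finally have R: "card ?R \<le> 1" by simp
  have "{X. X < m \<and> real X / m < x \<and> real (q X) / m < y} \<subseteq> {X. X < a \<and> q X < b} \<union> ({a} \<union> ?R)"
    unfolding div using x(2) y(2) by auto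
  then have "card {X. X < m \<and> real X / m < x \<and> real (q X) / m < y}
      \<le> card ({X. X < a \<and> q X < b} \<union> ({a} \<union> ?R))"
    by (intro card_mono) auto
  also have "\<dots> \<le> card {X. X < a \<and> q X < b} + (card {a} + card ?R)"
    by (intro order_trans[OF card_Un_le] add_left_mono card_Un_le)
  finally show "card {X. X < m \<and> real X / m < x \<and> real (q X) / m < y}
      \<le> card {X. X < a \<and> q X < b} + 2"
    using R by simp
qed

text \<open>Off the grid the two point counts grow by at most \<open>2\<close> each and the scaled
  area by at most \<open>4\<close>. These changes enter with opposite signs, so the error stays
  within \<open>4\<close>.\<close>

lemma local_discrepancy_near_partial_sum:
  assumes "n \<ge> 1" "a < 2 ^ n" "b < 2 ^ n"
    and x: "real a \<le> 2 ^ n * x" "2 ^ n * x \<le> real a + 1"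
    and y: "real b \<le> 2 ^ n * y" "2 ^ n * y \<le> real b + 1"
  shows "\<bar>2 ^ (n + 1) * local_discrepancy (sym_shifted_hammersley n \<sigma>) (x, y)
    - partial_sum n \<sigma> (strip_excess n b) a\<bar> \<le> 4"
proof -
  define q where "q = digit_reversal n \<sigma>"
  define q' where "q' X = 2 ^ n - 1 - q X" for X
  define P where "P = sym_shifted_hammersley n \<sigma>"
  have q_less: "q X < 2 ^ n" for X by (simp add: q_def digit_reversal_less)
  have inj: "inj_on q {..<2 ^ n}"
    using bij_betw_digit_reversal unfolding q_def bij_betw_def by blast
  have inj': "inj_on q' {..<2 ^ n}"
  proof (rule inj_onI)
    fix X Y assume "X \<in> {..<2 ^ n}" "Y \<in> {..<2 ^ n}" "q' X = q' Y"
    moreover from this(3) have "q X = q Y"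
      unfolding q'_def using q_less[of X] q_less[of Y] by linarith
    ultimately show "X = Y" using inj_onD[OF inj] by blast
  qed
  let ?c = "\<lambda>q. card {X. X < a \<and> q X < b}"
  let ?C = "\<lambda>q. card {X. X < 2 ^ n \<and> real X / 2 ^ n < x \<and> real (q X) / 2 ^ n < y}"
  have bounds: "?c q \<le> ?C q" "?C q \<le> ?c q + 2" "?c q' \<le> ?C q'" "?C q' \<le> ?c q' + 2"
    using grid_count_bounds[OF inj assms(2), of x b y] grid_count_bounds[OF inj' assms(2), of x b y] x y
    by simp_all
  have "card (P \<inter> {0..<x} \<times> {0..<y}) = ?C q + ?C q'"
    unfolding P_def card_sym_shifted_hammersley_filter[OF assms(1)] q_def[symmetric] q'_def[symmetric]
    by simp
  moreover have "partial_sum n \<sigma> (strip_excess n b) a = real (?c q) + real (?c q') - 2 * real a * real b / 2 ^ n"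
  proof -
    have c: "(\<Sum>X<a. of_bool (r X < b)) = real (?c r)" for r :: "nat \<Rightarrow> nat"
    proof -
      have "{..<a} \<inter> {X. r X < b} = {X. X < a \<and> r X < b}" by auto
      then show ?thesis by (simp add: of_bool_def sum.If_cases)
    qed
    show ?thesis
      unfolding partial_sum_def strip_excess_def q_def[symmetric] q'_def[symmetric]
        sum_subtractf sum.distrib c by simp
  qed
  moreover have "2 ^ (n + 1) * local_discrepancy P (x, y)
      = real (card (P \<inter> {0..<x} \<times> {0..<y})) - 2 * 2 ^ n * (x * y)"
    unfolding local_discrepancy_def P_def card_sym_shifted_hammersley[OF assms(1)]
    by (simp add: field_simps)
  moreover have "2 * real a * real b / 2 ^ n \<le> 2 * 2 ^ n * (x * y)"
    and "2 * 2 ^ n * (x * y) \<le> 2 * real a * real b / 2 ^ n + 4"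
  proof -
    have eq: "2 * 2 ^ n * (x * y) = 2 * ((2 ^ n * x) * (2 ^ n * y)) / 2 ^ n" by simp
    have "real a * real b \<le> (2 ^ n * x) * (2 ^ n * y)"
      using x y by (intro mult_mono) auto
    then show "2 * real a * real b / 2 ^ n \<le> 2 * 2 ^ n * (x * y)"
      unfolding eq by (intro divide_right_mono) auto
    have ab: "real a + 1 \<le> 2 ^ n" "real b + 1 \<le> 2 ^ n"
      using of_nat_mono[OF Suc_leI[OF assms(2)], where ?'a = real]
        of_nat_mono[OF Suc_leI[OF assms(3)], where ?'a = real] by simp_all
    have "(2 ^ n * x) * (2 ^ n * y) \<le> (real a + 1) * (real b + 1)"
      using x y by (intro mult_mono) auto
    \<comment> \<open>The surplus is \<open>a + b + 1\<close>, below \<open>2 * 2 ^ n\<close>;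
      multiplied by \<open>2 / 2 ^ n\<close> it yields the \<open>4\<close>.\<close>
    also have "\<dots> \<le> real a * real b + 2 * 2 ^ n" using ab by (simp add: algebra_simps)
    finally have "2 * ((2 ^ n * x) * (2 ^ n * y)) / 2 ^ n \<le> 2 * (real a * real b + 2 * 2 ^ n) / 2 ^ n"
      by (intro divide_right_mono) auto
    then show "2 * 2 ^ n * (x * y) \<le> 2 * real a * real b / 2 ^ n + 4"
      unfolding eq by (simp add: field_simps)
  qed
  ultimately show ?thesis
    unfolding P_def[symmetric] using bounds by linarith
qed

lemma ex_grid_index:
  fixes x :: real
  assumes "0 < m" "0 \<le> x" "x \<le> 1"
  shows "\<exists>a<m. real a \<le> real m * x \<and> real m * x \<le> real a + 1"
proof (cases "x = 1")
  case True
  \<comment> \<open>The point \<open>1\<close> is assigned to the last closed cell, since the floor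
    would give the index \<open>m\<close>.\<close>
  then show ?thesis using assms by (intro exI[of _ "m - 1"]) (auto simp: of_nat_diff)
next
  case False
  have "real m * x < real m" using False assms by simp
  moreover have "0 \<le> real m * x" using assms by simp
  ultimately have "nat \<lfloor>real m * x\<rfloor> < m" by linarith
  moreover have "real (nat \<lfloor>real m * x\<rfloor>) \<le> real m * x" "real m * x \<le> real (nat \<lfloor>real m * x\<rfloor>) + 1"
    using \<open>0 \<le> real m * x\<close> by linarith+
  ultimately show ?thesis by blast
qed

text \<open>The closed cells cover the square and each has area \<open>1 / m\<^sup>2\<close>.
  Overlapping edges only enlarge the majorant, as \<open>c\<close> is nonnegative.\<close>

lemma set_integral_le_grid_sum:
  fixes f :: "real \<times> real \<Rightarrow> real" and c :: "nat \<Rightarrow> nat \<Rightarrow> real"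
  assumes "0 < m" and c: "\<And>a b. 0 \<le> c a b"
    and f: "\<And>a b x y. \<lbrakk>a < m; b < m; real a \<le> real m * x; real m * x \<le> real a + 1;
      real b \<le> real m * y; real m * y \<le> real b + 1\<rbrakk> \<Longrightarrow> f (x, y) \<le> c a b"
  shows "(LINT t:{0..1} \<times> {0..1}|lborel. f t) \<le> (\<Sum>a<m. \<Sum>b<m. c a b) / (real m)\<^sup>2"
proof -
  define Q where "Q a b = cbox (real a / m, real b / m) ((real a + 1) / m, (real b + 1) / m)" for a b
  define g where "g t = (\<Sum>a<m. \<Sum>b<m. c a b * indicator (Q a b) t)" for t
  have Q: "integrable lborel (indicator (Q a b) :: _ \<Rightarrow> real)" for a b
    unfolding Q_def using emeasure_lborel_cbox_finite by (intro integrable_real_indicator) auto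
  have vol: "measure lborel (Q a b) = 1 / (real m)\<^sup>2" for a b
    unfolding Q_def content_Pair
    using assms(1) by (simp add: divide_right_mono diff_divide_distrib[symmetric] power2_eq_square)
  have g0: "0 \<le> g t" for t
    unfolding g_def by (intro sum_nonneg mult_nonneg_nonneg c) auto
  have "(LINT t:{0..1} \<times> {0..1}|lborel. f t) \<le> (LINT t|lborel. g t)"
    unfolding set_lebesgue_integral_def
  proof (rule integral_mono')
    show "integrable lborel g"
      unfolding g_def by (intro Bochner_Integration.integrable_sum integrable_mult_right Q)
    fix t :: "real \<times> real"
    show "0 \<le> g t" by (rule g0)
    show "indicator ({0..1} \<times> {0..1}) t *\<^sub>R f t \<le> g t"
    proof (cases "t \<in> {0..1} \<times> {0..1}")
      case True
      obtain x y where t: "t = (x, y)" by fastforce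
      with True have "0 \<le> x" "x \<le> 1" "0 \<le> y" "y \<le> 1" by auto
      then obtain a b where a: "a < m" "real a \<le> real m * x" "real m * x \<le> real a + 1"
        and b: "b < m" "real b \<le> real m * y" "real m * y \<le> real b + 1"
        using ex_grid_index[OF assms(1)] by meson
      have "t \<in> Q a b"
        unfolding Q_def t using a b assms(1)
        by (simp add: cbox_Pair_eq pos_divide_le_eq pos_le_divide_eq mult.commute)
      then have "f t \<le> c a b * indicator (Q a b) t"
        using f[OF a(1) b(1) a(2,3) b(2,3)] by (simp add: t)
      also have "\<dots> \<le> (\<Sum>b<m. c a b * indicator (Q a b) t)"
        using b(1) by (intro member_le_sum[of b "{..<m}" "\<lambda>b. c a b * indicator (Q a b) t"]) (auto simp: c)
      also have "\<dots> \<le> g t"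
        unfolding g_def using a(1)
        by (intro member_le_sum[of a "{..<m}" "\<lambda>a. \<Sum>b<m. c a b * indicator (Q a b) t"])
          (auto intro!: sum_nonneg simp: c)
      finally show ?thesis using True by simp
    qed (simp add: g0)
  qed
  also have "\<dots> = (\<Sum>a<m. \<Sum>b<m. c a b * measure lborel (Q a b))"
  proof -
    have i: "integrable lborel (\<lambda>t. c a b * indicator (Q a b) t)" for a b
      by (intro integrable_mult_right Q)
    have "(LINT t|lborel. c a b * indicator (Q a b) t) = c a b * measure lborel (Q a b)" for a b
      by (simp add: Q_def)
    moreover have "(LINT t|lborel. (\<Sum>b<m. c a b * indicator (Q a b) t))
        = (\<Sum>b<m. LINT t|lborel. c a b * indicator (Q a b) t)" for a
      by (intro Bochner_Integration.integral_sum i)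
    moreover have "(LINT t|lborel. g t) = (\<Sum>a<m. LINT t|lborel. (\<Sum>b<m. c a b * indicator (Q a b) t))"
      unfolding g_def
      by (intro Bochner_Integration.integral_sum Bochner_Integration.integrable_sum i)
    ultimately show ?thesis by simp
  qed
  finally show ?thesis by (simp add: vol sum_divide_distrib)
qed

section \<open>Moments of the discrepancy\<close>

text \<open>Raise \<open>u \<le> exp u\<close> at \<open>u = z / p\<close> to the power
  \<open>p\<close>.\<close>

lemma powr_le_exp:
  fixes p z :: real
  assumes "0 < p" "0 \<le> z"
  shows "z powr p \<le> p powr p * exp z"
proof -
  have "z / p \<le> exp (z / p)" using exp_ge_add_one_self[of "z / p"] by linarith
  then have "(z / p) powr p \<le> exp (z / p) powr p" using assms by (intro powr_mono2) auto
  also have "\<dots> = exp z" using assms by (simp add: exp_powr_real)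
  finally show ?thesis using assms by (simp add: powr_divide pos_divide_le_eq mult.commute)
qed

lemma powr_integral_discrepancy_le:
  assumes "0 < p" "n \<ge> 1"
  shows "(LINT t:{0..1} \<times> {0..1}|lborel.
      \<bar>local_discrepancy (sym_shifted_hammersley n \<sigma>) t\<bar> powr p)
    \<le> (sqrt n / 2 ^ (n + 1)) powr p * (2 * p powr p * exp 8)"
proof -
  \<comment> \<open>This scale turns the moment bound \<open>exp (l\<^sup>2 * 4 * n)\<close> into
    the constant \<open>exp 4\<close>.\<close>
  define l where "l = 1 / sqrt n"
  define r where "r = sqrt n / 2 ^ (n + 1)"
  \<comment> \<open>Here \<open>exp 4\<close> absorbs the off-grid error \<open>4\<close>, which is
    scaled by \<open>l \<le> 1\<close>.\<close>
  define A where "A = r powr p * p powr p * exp 4"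
  define S where "S b a = partial_sum n \<sigma> (strip_excess n b) a" for b a
  define c where "c a b = A * (exp (l * S b a) + exp (- l * S b a))" for a b
  have n: "1 \<le> sqrt n" using assms(2) by simp
  then have l: "0 < l" "l \<le> 1" "l\<^sup>2 * 4 * n = 4"
    using assms(2) by (simp_all add: l_def power_divide)
  have A: "0 \<le> A" by (simp add: A_def)
  have "(LINT t:{0..1} \<times> {0..1}|lborel. \<bar>local_discrepancy (sym_shifted_hammersley n \<sigma>) t\<bar> powr p)
      \<le> (\<Sum>a<2 ^ n. \<Sum>b<2 ^ n. c a b) / (real (2 ^ n))\<^sup>2"
  proof (rule set_integral_le_grid_sum)
    show "0 \<le> c a b" for a b unfolding c_def using A by (intro mult_nonneg_nonneg) (auto intro: add_nonneg_nonneg)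
    fix a b and x y :: real
    assume h: "a < 2 ^ n" "b < 2 ^ n" "real a \<le> real (2 ^ n) * x" "real (2 ^ n) * x \<le> real a + 1"
      "real b \<le> real (2 ^ n) * y" "real (2 ^ n) * y \<le> real b + 1"
    define D where "D = local_discrepancy (sym_shifted_hammersley n \<sigma>) (x, y)"
    define z where "z = l * \<bar>2 ^ (n + 1) * D\<bar>"
    have "\<bar>2 ^ (n + 1) * D - S b a\<bar> \<le> 4"
      unfolding D_def S_def using h by (intro local_discrepancy_near_partial_sum[OF assms(2)]) auto
    then have "\<bar>2 ^ (n + 1) * D\<bar> \<le> \<bar>S b a\<bar> + 4" by linarith
    then have "z \<le> l * (\<bar>S b a\<bar> + 4)" unfolding z_def using l by (intro mult_left_mono) auto
    also have "\<dots> \<le> \<bar>l * S b a\<bar> + 4" using l by (simp add: abs_mult distrib_left)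
    finally have "exp z \<le> exp (\<bar>l * S b a\<bar> + 4)" by simp
    also have "\<dots> = exp 4 * exp \<bar>l * S b a\<bar>" by (simp add: exp_add)
    also have "\<dots> \<le> exp 4 * (exp (l * S b a) + exp (- l * S b a))"
      by (intro mult_left_mono) (auto simp: abs_if)
    finally have ez: "exp z \<le> exp 4 * (exp (l * S b a) + exp (- l * S b a))" .
    have "\<bar>D\<bar> = r * z" using n by (simp add: r_def z_def l_def abs_mult)
    moreover have "0 \<le> r" "0 \<le> z" using l by (simp_all add: r_def z_def)
    ultimately have "\<bar>D\<bar> powr p = r powr p * z powr p"
      by (simp only: powr_mult)
    also have "\<dots> \<le> r powr p * (p powr p * exp z)"
      using l assms(1) by (intro mult_left_mono powr_le_exp) (auto simp: z_def)
    also have "\<dots> \<le> r powr p * (p powr p * (exp 4 * (exp (l * S b a) + exp (- l * S b a))))"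
      using ez by (intro mult_left_mono) auto
    also have "\<dots> = c a b" by (simp add: c_def A_def mult.assoc)
    finally show "\<bar>local_discrepancy (sym_shifted_hammersley n \<sigma>) (x, y)\<bar> powr p \<le> c a b"
      unfolding D_def .
  qed simp
  \<comment> \<open>The exponential moments are controlled over \<open>a\<close> for each fixed
    \<open>b\<close>, so the sum over \<open>a\<close> has to be the inner one.\<close>
  also have "(\<Sum>a<2 ^ n. \<Sum>b<2 ^ n. c a b) = (\<Sum>b<2 ^ n. \<Sum>a<2 ^ n. c a b)"
    by (rule sum.swap)
  also have "\<dots> \<le> (\<Sum>b<(2::nat) ^ n. A * (2 * (2 ^ n * exp 4)))"
  proof (rule sum_mono)
    fix b :: nat assume "b \<in> {..<2 ^ n}"
    then have b: "b \<le> 2 ^ n" by simp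
    have "(\<Sum>a<2 ^ n. exp (l * S b a)) \<le> 2 ^ n * exp 4"
      using exp_moment_strip_excess_le[OF b, of l \<sigma>] l(3) unfolding S_def by simp
    moreover have "(\<Sum>a<2 ^ n. exp (- l * S b a)) \<le> 2 ^ n * exp 4"
      using exp_moment_strip_excess_le[OF b, of "-l" \<sigma>] l(3) unfolding S_def by simp
    ultimately show "(\<Sum>a<2 ^ n. c a b) \<le> A * (2 * (2 ^ n * exp 4))"
      unfolding c_def sum_distrib_left[symmetric] sum.distrib using A by (intro mult_left_mono) auto
  qed
  also have "(\<Sum>b<(2::nat) ^ n. A * (2 * (2 ^ n * exp 4))) = (real (2 ^ n))\<^sup>2 * (2 * A * exp 4)"
    by (simp add: power2_eq_square)
  finally have "(LINT t:{0..1} \<times> {0..1}|lborel.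
      \<bar>local_discrepancy (sym_shifted_hammersley n \<sigma>) t\<bar> powr p) \<le> 2 * A * exp 4"
    by (simp add: divide_right_mono)
  \<comment> \<open>One \<open>exp 4\<close> comes from the off-grid error and one from the moment
    bound; the \<open>2\<close> counts the two signs of \<open>l\<close>.\<close>
  also have "2 * A * exp 4 = r powr p * (2 * p powr p * exp 8)"
    by (simp add: A_def flip: exp_add)
  finally show ?thesis unfolding r_def .
qed

theorem theorem2:
  fixes p :: real
  assumes "1 < p"
  shows "\<exists>C>0. \<forall>n\<ge>1. \<forall>\<sigma> \<in> {1..n} \<rightarrow> {0, 1}.
           card (sym_shifted_hammersley n \<sigma>) = 2 ^ (n + 1) \<and>
           Lp_discrepancy p (sym_shifted_hammersley n \<sigma>)
             \<le> C * (sqrt (ln (2 ^ (n + 1))) / 2 ^ (n + 1))"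
proof -
  \<comment> \<open>The \<open>p\<close>-th root of the factor free of \<open>n\<close> and
    \<open>\<sigma>\<close> in \<open>powr_integral_discrepancy_le\<close>.\<close>
  define K where "K = (2 * p powr p * exp 8) powr (1 / p)"
  have K: "0 < K" unfolding K_def using assms by simp
  have "Lp_discrepancy p (sym_shifted_hammersley n \<sigma>)
      \<le> (sqrt 2 * K) * (sqrt (ln (2 ^ (n + 1))) / 2 ^ (n + 1))" if n: "n \<ge> 1" for n \<sigma>
  proof -
    let ?r = "sqrt n / 2 ^ (n + 1)"
    let ?I = "LINT t:{0..1} \<times> {0..1}|lborel.
      \<bar>local_discrepancy (sym_shifted_hammersley n \<sigma>) t\<bar> powr p"
    have "0 \<le> ?I" unfolding set_lebesgue_integral_def by (intro Bochner_Integration.integral_nonneg) auto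
    then have "?I powr (1 / p) \<le> (?r powr p * (2 * p powr p * exp 8)) powr (1 / p)"
      using powr_integral_discrepancy_le[of p n \<sigma>] assms n by (intro powr_mono2) auto
    also have "\<dots> = ?r * K" using assms by (simp add: K_def powr_mult powr_powr)
    also have "\<dots> \<le> (sqrt 2 * sqrt (ln (2 ^ (n + 1))) / 2 ^ (n + 1)) * K"
    proof -
      define L where "L = ln (2 ^ (n + 1) :: real)"
      \<comment> \<open>This converts \<open>n\<close> into the logarithm of the number of points
        and is the source of \<open>sqrt 2\<close> in the constant.\<close>
      have "1 / 2 \<le> ln (2::real)" using ln2_ge_two_thirds by simp
      then have "real (n + 1) * (1 / 2) \<le> real (n + 1) * ln 2" by (intro mult_left_mono) auto
      also have "\<dots> = L" unfolding L_def by (rule ln_realpow[symmetric])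
      finally have "real n \<le> 2 * L" by simp
      then have "real n \<le> 2 * ln (2 ^ (n + 1))" unfolding L_def .
      then have "sqrt n \<le> sqrt 2 * sqrt (ln (2 ^ (n + 1)))"
        unfolding real_sqrt_mult[symmetric] by (rule real_sqrt_le_mono)
      then show ?thesis using K by (intro mult_right_mono divide_right_mono) simp_all
    qed
    also have "\<dots> = (sqrt 2 * K) * (sqrt (ln (2 ^ (n + 1))) / 2 ^ (n + 1))"
      by (simp only: times_divide_eq_right mult.commute[of _ K] mult.assoc)
    finally show ?thesis unfolding Lp_discrepancy_def .
  qed
  moreover have "0 < sqrt 2 * K" using K by simp
  ultimately show ?thesis using card_sym_shifted_hammersley by (intro exI[of _ "sqrt 2 * K"]) simp
qed

end
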